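(* For every integer $n\geq 3$, writing $f_q(n)$ for the total number of occurrences of the pattern $q$ in all permutations of $S_n(132,213,231)$, we have $$f_{123}(n)=f_{312}(n)=\binom{n+1}{4},\qquad f_{321}(n)=\frac{n(n-2)(n-1)^2}{12}.$$
   Context: $S_n$ is the set of permutations of $\{1,\dots,n\}$ written in one-line notation $\sigma=\sigma_1\sigma_2\cdots\sigma_n$. For $q\in S_k$, an occurrence of the pattern $q$ in $\sigma\in S_n$ is a choice of indices $i_1<i_2<\cdots<i_k$ in $\{1,\dots,n\}$ such that for all $1\le j,l\le k$, $q_j<q_l$ if and only if $\sigma_{i_j}<\sigma_{i_l}$. Let $f_q(\sigma)$ be the number of occurrences of $q$ in $\sigma$; $\sigma$ avoids $q$ if $f_q(\sigma)=0$. $S_n(132,213,231)$ is the set of permutations in $S_n$ avoiding all of $132$, $213$ and $231$, and $f_q(n)=\sum_{\sigma\in S_n(132,213,231)}f_q(\sigma)$. *)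

theory Defs
  imports Complex_Main "HOL-Combinatorics.Multiset_Permutations"
begin

text \<open>
  Permutations of \<open>{1..n}\<close> are represented by their one-line notation, a list of natural numbers.
  Values are 1-based, whereas list positions (hence the indices of an occurrence) are 0-based.
\<close>

definition Perms :: "nat \<Rightarrow> nat list set" where
  "Perms n = permutations_of_set {1..n}"

text \<open>
  A choice of indices \<open>i\<^sub>1 < \<dots> < i\<^sub>k\<close> is given as a strictly increasing list.
\<close>

definition occurrences :: "nat list \<Rightarrow> nat list \<Rightarrow> nat list set" where
  "occurrences q \<sigma> =
    {is. length is = length q \<and> sorted_wrt (<) is \<and> set is \<subseteq> {..<length \<sigma>} \<and>
         (\<forall>j<length q. \<forall>l<length q. q ! j < q ! l \<longleftrightarrow> \<sigma> ! (is ! j) < \<sigma> ! (is ! l))}"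

definition occ_count :: "nat list \<Rightarrow> nat list \<Rightarrow> nat" where
  "occ_count q \<sigma> = card (occurrences q \<sigma>)"

definition avoids :: "nat list \<Rightarrow> nat list \<Rightarrow> bool" where
  "avoids \<sigma> q \<longleftrightarrow> occ_count q \<sigma> = 0"

definition Avoiders :: "nat \<Rightarrow> nat list set \<Rightarrow> nat list set" where
  "Avoiders n Q = {\<sigma> \<in> Perms n. \<forall>q\<in>Q. avoids \<sigma> q}"

definition total_occ :: "nat list \<Rightarrow> nat \<Rightarrow> nat" where
  "total_occ q n = (\<Sum>\<sigma>\<in>Avoiders n {[1,3,2], [2,1,3], [2,3,1]}. occ_count q \<sigma>)"

text \<open>
  All these sets are finite, so \<^const>\<open>card\<close> and \<^const>\<open>sum\<close> have their intended meaning here.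
\<close>

lemma finite_occurrences: "finite (occurrences q \<sigma>)"
  by (rule finite_subset[OF _ finite_lists_length_eq[of "{..<length \<sigma>}" "length q"]])
     (auto simp: occurrences_def)

lemma finite_Avoiders: "finite (Avoiders n Q)"
  by (simp add: Avoiders_def Perms_def)

end

theory Submission
  imports Defs
begin

text \<open>
  Avoiding \<open>132\<close> and \<open>231\<close> forbids interior peaks, so the maximum of an avoider is its first or last
  entry; in the latter case avoiding \<open>213\<close> makes the avoider increasing. By induction the avoiders
  are exactly the \<open>n\<close> words \<open>n, n - 1, \<dots>, k + 1, 1, 2, \<dots>, k\<close> with \<open>1 \<le> k \<le> n\<close>. In such a word the
  entries at positions \<open>i < j\<close> form an ascent iff \<open>i\<close> lies in the increasing part. Hence it contains
  \<open>k choose 3\<close> occurrences of \<open>123\<close>, \<open>(n - k) * (k choose 2)\<close> of \<open>312\<close>, and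
  \<open>(n - k choose 3) + (n - k choose 2) * k\<close> of \<open>321\<close>; it remains to sum over \<open>k\<close>.
\<close>

section \<open>Increasing lists of indices\<close>

text \<open>The index lists of \<open>occurrences\<close> before any pattern is imposed; they encode
  the \<open>m\<close>-element subsets of \<open>A\<close>.\<close>

definition inc_lists :: "nat \<Rightarrow> nat set \<Rightarrow> nat list set" where
  "inc_lists m A = {is. length is = m \<and> sorted_wrt (<) is \<and> set is \<subseteq> A}"

lemma finite_inc_lists: "finite A \<Longrightarrow> finite (inc_lists m A)"
  by (rule finite_subset[OF _ finite_lists_length_eq[of A m]]) (auto simp: inc_lists_def)

lemma card_inc_lists:
  assumes "finite A"
  shows "card (inc_lists m A) = card A choose m"
proof -
  have "bij_betw set (inc_lists m A) {B. B \<subseteq> A \<and> card B = m}"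
  proof (rule bij_betw_byWitness[where f' = sorted_list_of_set])
    show "\<forall>is\<in>inc_lists m A. sorted_list_of_set (set is) = is"
      by (auto simp: inc_lists_def strict_sorted_iff sorted_list_of_set.idem_if_sorted_distinct)
    show "\<forall>B\<in>{B. B \<subseteq> A \<and> card B = m}. set (sorted_list_of_set B) = B"
      using finite_subset[OF _ assms] by simp
    show "set ` inc_lists m A \<subseteq> {B. B \<subseteq> A \<and> card B = m}"
      by (auto simp: inc_lists_def strict_sorted_iff distinct_card)
    show "sorted_list_of_set ` {B. B \<subseteq> A \<and> card B = m} \<subseteq> inc_lists m A"
      using finite_subset[OF _ assms] by (auto simp: inc_lists_def)
  qed
  then show ?thesis
    using n_subsets[OF assms] by (simp add: bij_betw_same_card)
qed

text \<open>Serves for occurrences split between two blocks of positions. Concatenation is injective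
  because the fixed length \<open>a\<close> shows where to cut.\<close>

lemma card_append_inc_lists:
  assumes "finite A" "finite B"
  shows "card ((\<lambda>(xs, ys). xs @ ys) ` (inc_lists a A \<times> inc_lists b B))
           = (card A choose a) * (card B choose b)"
proof -
  have "inj_on (\<lambda>(xs, ys). xs @ ys) (inc_lists a A \<times> inc_lists b B)"
    by (auto simp: inj_on_def inc_lists_def)
  then show ?thesis
    using assms by (simp add: card_image card_cartesian_product card_inc_lists)
qed

lemma inc_lists_1: "inc_lists 1 A = (\<lambda>i. [i]) ` A"
  by (auto simp: inc_lists_def length_Suc_conv)

lemma inc_lists_2: "inc_lists 2 A = {[i, j] | i j. i < j \<and> {i, j} \<subseteq> A}"
  by (auto simp: inc_lists_def length_Suc_conv numeral_2_eq_2)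

lemma inc_lists_3: "inc_lists 3 A = {[i, j, l] | i j l. i < j \<and> j < l \<and> {i, j, l} \<subseteq> A}"
  by (auto simp: inc_lists_def length_Suc_conv numeral_3_eq_3)

section \<open>Patterns of length three\<close>

text \<open>Of the nine conditions on index pairs in \<open>occurrences\<close>, the three diagonal
  ones are trivial; these are the other six.\<close>

definition matches3 :: "nat \<Rightarrow> nat \<Rightarrow> nat \<Rightarrow> nat \<Rightarrow> nat \<Rightarrow> nat \<Rightarrow> bool" where
  "matches3 p q r x y z \<longleftrightarrow>
     (p < q \<longleftrightarrow> x < y) \<and> (q < p \<longleftrightarrow> y < x) \<and> (p < r \<longleftrightarrow> x < z) \<and> (r < p \<longleftrightarrow> z < x) \<and>
     (q < r \<longleftrightarrow> y < z) \<and> (r < q \<longleftrightarrow> z < y)"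

lemma occurrences_3:
  "occurrences [p, q, r] \<sigma> =
     {[i, j, l] | i j l. i < j \<and> j < l \<and> l < length \<sigma> \<and> matches3 p q r (\<sigma> ! i) (\<sigma> ! j) (\<sigma> ! l)}"
  (is "?L = ?R")
proof -
  have all3: "(\<forall>j<Suc (Suc (Suc 0)). P j) \<longleftrightarrow> P 0 \<and> P 1 \<and> P 2" for P :: "nat \<Rightarrow> bool"
    by (auto simp: numeral_2_eq_2 less_Suc_eq)
  have "(\<forall>j<length [p, q, r]. \<forall>l<length [p, q, r]. [p, q, r] ! j < [p, q, r] ! l \<longleftrightarrow> f j < f l)
          \<longleftrightarrow> matches3 p q r (f 0) (f 1) (f 2)" for f :: "nat \<Rightarrow> nat"
    by (simp add: all3 matches3_def) blast
  then have "?L = {is \<in> inc_lists 3 {..<length \<sigma>}.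
                matches3 p q r (\<sigma> ! (is ! 0)) (\<sigma> ! (is ! 1)) (\<sigma> ! (is ! 2))}"
    unfolding occurrences_def inc_lists_def by (simp add: numeral_3_eq_3)
  then show ?thesis
    by (auto simp: inc_lists_3)
qed

lemma avoids_3:
  "avoids \<sigma> [p, q, r] \<longleftrightarrow>
     (\<forall>i j l. i < j \<longrightarrow> j < l \<longrightarrow> l < length \<sigma> \<longrightarrow> \<not> matches3 p q r (\<sigma> ! i) (\<sigma> ! j) (\<sigma> ! l))"
proof -
  have "avoids \<sigma> [p, q, r] \<longleftrightarrow> occurrences [p, q, r] \<sigma> = {}"
    by (simp add: avoids_def occ_count_def finite_occurrences)
  then show ?thesis
    unfolding occurrences_3 by blast
qed

section \<open>The avoiders\<close>

text \<open>Stands for avoiding 132 and 231 together: the two patterns differ only in how the outer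
  entries compare, which drops out of the joint condition.\<close>

definition no_peak :: "nat list \<Rightarrow> bool" where
  "no_peak \<sigma> \<longleftrightarrow> (\<forall>i j l. i < j \<longrightarrow> j < l \<longrightarrow> l < length \<sigma> \<longrightarrow> \<not> (\<sigma> ! i < \<sigma> ! j \<and> \<sigma> ! l < \<sigma> ! j))"

definition no_213 :: "nat list \<Rightarrow> bool" where
  "no_213 \<sigma> \<longleftrightarrow> (\<forall>i j l. i < j \<longrightarrow> j < l \<longrightarrow> l < length \<sigma> \<longrightarrow> \<not> (\<sigma> ! j < \<sigma> ! i \<and> \<sigma> ! i < \<sigma> ! l))"

lemma Avoiders_iff:
  "\<sigma> \<in> Avoiders n {[1,3,2], [2,1,3], [2,3,1]} \<longleftrightarrow>
     distinct \<sigma> \<and> set \<sigma> = {1..n} \<and> no_peak \<sigma> \<and> no_213 \<sigma>"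
proof (cases "distinct \<sigma>")
  case True
  \<comment> \<open>Distinctness excludes equal outer entries, the one case in which a peak would
    match neither pattern.\<close>
  have peak: "matches3 1 3 2 (\<sigma> ! i) (\<sigma> ! j) (\<sigma> ! l) \<or> matches3 2 3 1 (\<sigma> ! i) (\<sigma> ! j) (\<sigma> ! l)
                \<longleftrightarrow> \<sigma> ! i < \<sigma> ! j \<and> \<sigma> ! l < \<sigma> ! j"
    if "i < j" "j < l" "l < length \<sigma>" for i j l
    using that True nth_eq_iff_index_eq[of \<sigma> i l] unfolding matches3_def by auto
  have "matches3 2 1 3 (\<sigma> ! i) (\<sigma> ! j) (\<sigma> ! l) \<longleftrightarrow> \<sigma> ! j < \<sigma> ! i \<and> \<sigma> ! i < \<sigma> ! l" for i j l
    unfolding matches3_def by auto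
  then have "avoids \<sigma> [2,1,3] \<longleftrightarrow> no_213 \<sigma>"
    by (simp add: avoids_3 no_213_def)
  moreover have "avoids \<sigma> [1,3,2] \<and> avoids \<sigma> [2,3,1] \<longleftrightarrow> no_peak \<sigma>"
    unfolding avoids_3 no_peak_def using peak by blast
  ultimately show ?thesis
    using True by (auto simp: Avoiders_def Perms_def permutations_of_set_def)
qed (auto simp: Avoiders_def Perms_def permutations_of_set_def)

text \<open>Since \<open>valley (Suc d) 0 = valley d 1\<close>, the representation is unique only
  under \<open>1 \<le> k\<close>.\<close>

definition valley :: "nat \<Rightarrow> nat \<Rightarrow> nat list" where
  "valley d k = rev [k + 1..<k + d + 1] @ [1..<k + 1]"

lemma length_valley [simp]: "length (valley d k) = d + k"
  by (simp add: valley_def)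

lemma set_valley: "set (valley d k) = {1..d + k}"
  by (auto simp: valley_def)

lemma distinct_valley: "distinct (valley d k)"
  by (auto simp: valley_def)

lemma valley_Suc: "valley (Suc d) k = Suc (d + k) # valley d k"
  by (simp add: valley_def add.commute)

lemma valley_nth:
  "i < d + k \<Longrightarrow> valley d k ! i = (if i < d then d + k - i else i - d + 1)"
  by (auto simp: valley_def nth_append rev_nth simp del: upt_Suc)

text \<open>A decreasing-block entry exceeds everything to its right, an increasing-block entry is
  below everything to its right. Pattern conditions thus become conditions on positions relative to
  \<open>d\<close>.\<close>

lemma valley_less_iff:
  assumes "i < j" "j < d + k"
  shows "valley d k ! i < valley d k ! j \<longleftrightarrow> d \<le> i"
    and "valley d k ! j < valley d k ! i \<longleftrightarrow> i < d"
  using assms by (auto simp: valley_nth)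

lemma no_peak_Cons: "no_peak (x # \<sigma>) \<Longrightarrow> no_peak \<sigma>"
  unfolding no_peak_def by (metis Suc_mono length_Cons nth_Cons_Suc)

lemma no_213_Cons: "no_213 (x # \<sigma>) \<Longrightarrow> no_213 \<sigma>"
  unfolding no_213_def by (metis Suc_mono length_Cons nth_Cons_Suc)

text \<open>A descent in \<open>\<sigma>\<close> followed by the larger \<open>m\<close> would be a
  213.\<close>

lemma no_213_last_max_sorted:
  assumes "no_213 (\<sigma> @ [m])" "\<forall>x\<in>set \<sigma>. x < m"
  shows "sorted \<sigma>"
  unfolding sorted_iff_nth_mono_less
proof (intro allI impI)
  fix i j assume ij: "i < j" "j < length \<sigma>"
  then have "\<not> ((\<sigma> @ [m]) ! j < (\<sigma> @ [m]) ! i \<and> (\<sigma> @ [m]) ! i < (\<sigma> @ [m]) ! length \<sigma>)"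
    using assms(1)[unfolded no_213_def, rule_format, of i j "length \<sigma>"] by simp
  then show "\<sigma> ! i \<le> \<sigma> ! j"
    using ij assms(2) by (auto simp: nth_append)
qed

lemma eq_valley:
  assumes "distinct \<sigma>" "set \<sigma> = {1..Suc n}" "no_peak \<sigma>" "no_213 \<sigma>"
  shows "\<exists>d k. d + k = Suc n \<and> 1 \<le> k \<and> \<sigma> = valley d k"
  using assms
proof (induction n arbitrary: \<sigma>)
  case 0
  then have "length \<sigma> = 1"
    using distinct_card[of \<sigma>] by simp
  then obtain x where "\<sigma> = [x]"
    by (auto simp: length_Suc_conv)
  then have "\<sigma> = valley 0 1"
    using "0.prems"(2) by (simp add: valley_def)
  then show ?case
    by force
next
  case (Suc n)
  let ?m = "Suc (Suc n)"
  have "?m \<in> set \<sigma>"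
    using Suc.prems(2) by auto
  then obtain xs ys where \<sigma>: "\<sigma> = xs @ ?m # ys"
    by (meson split_list)
  have rest: "set xs \<union> set ys = {1..Suc n}"
  proof -
    have "set xs \<union> set ys = set \<sigma> - {?m}"
      using Suc.prems(1) \<sigma> by auto
    also have "\<dots> = {1..Suc n}"
      unfolding Suc.prems(2) by (auto simp: le_Suc_eq)
    finally show ?thesis .
  qed
  have "xs = [] \<or> ys = []"
  proof (rule ccontr)
    assume "\<not> (xs = [] \<or> ys = [])"
    then have ne: "xs \<noteq> []" "ys \<noteq> []"
      by auto
    then have "xs ! 0 \<le> Suc n" "ys ! 0 \<le> Suc n"
      using rest nth_mem[of 0 xs] nth_mem[of 0 ys] by auto
    \<comment> \<open>The candidate peak consists of the first entry, the maximum and the entry just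
      after it.\<close>
    moreover have "\<not> (\<sigma> ! 0 < \<sigma> ! length xs \<and> \<sigma> ! Suc (length xs) < \<sigma> ! length xs)"
      using Suc.prems(3)[unfolded no_peak_def, rule_format, of 0 "length xs" "Suc (length xs)"] ne
      by (simp add: \<sigma>)
    ultimately show False
      using ne by (auto simp: \<sigma> nth_append)
  qed
  then show ?case
  proof
    \<comment> \<open>A leading maximum lengthens the decreasing block of the remaining valley by
      one.\<close>
    assume xs: "xs = []"
    then obtain d k where "d + k = Suc n" "1 \<le> k" "ys = valley d k"
      using Suc.IH[of ys] Suc.prems rest no_peak_Cons no_213_Cons unfolding \<sigma> by auto
    then have "Suc d + k = Suc (Suc n) \<and> 1 \<le> k \<and> \<sigma> = valley (Suc d) k"
      by (simp add: valley_Suc \<sigma> xs)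
    then show ?thesis
      by blast
  next
    assume ys: "ys = []"
    have "sorted xs"
      using no_213_last_max_sorted[of xs ?m] Suc.prems(4) rest unfolding \<sigma> ys by force
    moreover have "distinct xs"
      using Suc.prems(1) by (simp add: \<sigma>)
    moreover have "set xs = set [1..<Suc (Suc n)]"
      using rest unfolding ys set_upt atLeastLessThanSuc_atLeastAtMost by simp
    ultimately have "xs = [1..<Suc (Suc n)]"
      by (metis distinct_upt sorted_distinct_set_unique sorted_upt)
    then have "\<sigma> = valley 0 (Suc (Suc n))"
      by (simp add: \<sigma> ys valley_def)
    then show ?thesis
      by force
  qed
qed

lemma Avoiders_eq_valleys:
  assumes "n \<ge> 1"
  shows "Avoiders n {[1,3,2], [2,1,3], [2,3,1]} = (\<lambda>k. valley (n - k) k) ` {1..n}"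
proof (intro equalityI subsetI)
  fix \<sigma> assume "\<sigma> \<in> Avoiders n {[1,3,2], [2,1,3], [2,3,1]}"
  then obtain d k where "d + k = n" "1 \<le> k" "\<sigma> = valley d k"
    using eq_valley[of \<sigma> "n - 1"] assms unfolding Avoiders_iff by auto
  then show "\<sigma> \<in> (\<lambda>k. valley (n - k) k) ` {1..n}"
    by (intro image_eqI[of _ _ k]) auto
next
  fix \<sigma> assume "\<sigma> \<in> (\<lambda>k. valley (n - k) k) ` {1..n}"
  then obtain k where k: "k \<le> n" "\<sigma> = valley (n - k) k"
    by auto
  \<comment> \<open>An ascent starts in the increasing block, after which nothing falls; a descent
    starts in the decreasing block, where the first entry exceeds all later ones.\<close>
  have "no_peak \<sigma>" "no_213 \<sigma>"
    using k(1) by (auto simp: no_peak_def no_213_def k(2) valley_less_iff)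
  then show "\<sigma> \<in> Avoiders n {[1,3,2], [2,1,3], [2,3,1]}"
    using k unfolding Avoiders_iff by (simp add: distinct_valley set_valley)
qed

text \<open>For \<open>k < k'\<close>, positions \<open>n - k'\<close> and \<open>n - k\<close>
  carry a descent in the valley of \<open>k\<close> and an ascent in that of \<open>k'\<close>. Here
  \<open>1 \<le> k\<close> puts \<open>n - k\<close> inside the list.\<close>

lemma inj_on_valley: "inj_on (\<lambda>k. valley (n - k) k) {1..n}"
proof (rule linorder_inj_onI)
  fix k k' assume kk: "k < k'" "k \<in> {1..n}" "k' \<in> {1..n}"
  then have "valley (n - k) k ! (n - k') > valley (n - k) k ! (n - k)"
    using valley_less_iff(2)[of "n - k'" "n - k" "n - k" k] by auto
  moreover have "valley (n - k') k' ! (n - k') < valley (n - k') k' ! (n - k)"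
    using kk valley_less_iff(1)[of "n - k'" "n - k" "n - k'" k'] by auto
  ultimately show "valley (n - k) k \<noteq> valley (n - k') k'"
    by auto
qed (auto)

lemma total_occ_eq:
  assumes "n \<ge> 1"
  shows "total_occ q n = (\<Sum>k=1..n. occ_count q (valley (n - k) k))"
  unfolding total_occ_def Avoiders_eq_valleys[OF assms]
  by (simp add: sum.reindex[OF inj_on_valley] del: One_nat_def)

section \<open>Occurrences in a single avoider\<close>

text \<open>The first index must lie in the increasing block, and then all three do.\<close>

lemma occ_count_123: "occ_count [1,2,3] (valley d k) = k choose 3"
proof -
  have "occurrences [1,2,3] (valley d k) = inc_lists 3 {d..<d + k}"
    unfolding occurrences_3 inc_lists_3
    by (fastforce simp: matches3_def valley_less_iff)
  then show ?thesis
    by (simp add: occ_count_def card_inc_lists)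
qed

text \<open>The descent puts the first index in the decreasing block, the ascent puts the other two
  in the increasing one.\<close>

lemma occ_count_312: "occ_count [3,1,2] (valley d k) = d * (k choose 2)"
proof -
  have "occurrences [3,1,2] (valley d k) =
          (\<lambda>(xs, ys). xs @ ys) ` (inc_lists 1 {..<d} \<times> inc_lists 2 {d..<d + k})"
    unfolding occurrences_3 inc_lists_1 inc_lists_2
    by (fastforce simp: matches3_def valley_less_iff image_iff)
  then show ?thesis
    by (simp only: occ_count_def) (simp add: card_append_inc_lists)
qed

text \<open>The first two indices lie in the decreasing block while the third is free; the two
  summands separate its possible blocks.\<close>

lemma occ_count_321: "occ_count [3,2,1] (valley d k) = (d choose 3) + (d choose 2) * k"
proof -
  let ?A = "inc_lists 3 {..<d}"
  let ?B = "(\<lambda>(xs, ys). xs @ ys) ` (inc_lists 2 {..<d} \<times> inc_lists 1 {d..<d + k})"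
  have B: "?B = {[i, j, l] | i j l. i < j \<and> j < d \<and> d \<le> l \<and> l < d + k}"
    unfolding inc_lists_1 inc_lists_2 by (fastforce simp: image_iff)
  have occ: "occurrences [3,2,1] (valley d k) = ?A \<union> ?B"
    unfolding occurrences_3 inc_lists_3 B
    by (fastforce simp: matches3_def valley_less_iff)
  have disj: "?A \<inter> ?B = {}"
    unfolding inc_lists_3 B by auto
  have "card (?A \<union> ?B) = card ?A + card ?B"
    by (rule card_Un_disjoint) (use disj in \<open>auto intro: finite_inc_lists\<close>)
  also have "card ?B = (d choose 2) * k"
    by (subst card_append_inc_lists) auto
  finally show ?thesis
    unfolding occ_count_def occ by (simp add: card_inc_lists)
qed

section \<open>Summation\<close>

text \<open>Hockey-stick identity; the lower index \<open>Suc m\<close> makes the absent term at 0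
  vanish.\<close>

lemma sum_choose_upper: "(\<Sum>k=1..n. k choose Suc m) = Suc n choose Suc (Suc m)"
  by (induction n) auto

lemma sum_rev_choose_upper: "(\<Sum>k=1..n. (n - k) choose m) = n choose Suc m"
proof -
  have "(\<Sum>k=1..n. (n - k) choose m) = (\<Sum>k<n. k choose m)"
    by (rule sum.reindex_bij_witness[of _ "\<lambda>k. n - k" "\<lambda>k. n - k"]) auto
  also have "\<dots> = n choose Suc m"
    by (induction n) auto
  finally show ?thesis .
qed

text \<open>Passing from \<open>n\<close> to \<open>Suc n\<close> adds one copy of each
  \<open>k choose Suc m\<close>, and the new last term is 0; the hockey-stick identity and Pascal's
  rule finish.\<close>

lemma sum_diff_mult_choose:
  "(\<Sum>k=1..n. (n - k) * (k choose Suc m)) = Suc n choose Suc (Suc (Suc m))"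
proof (induction n)
  case (Suc n)
  have "(\<Sum>k=1..Suc n. (Suc n - k) * (k choose Suc m))
          = (\<Sum>k=1..n. (n - k) * (k choose Suc m)) + (\<Sum>k=1..n. k choose Suc m)"
    by (simp add: Suc_diff_le add.commute flip: sum.distrib)
  then show ?case
    by (simp only: Suc.IH sum_choose_upper) simp
qed simp

lemma sum_rev_choose_mult:
  "(\<Sum>k=1..n. ((n - k) choose Suc m) * k) = Suc n choose Suc (Suc (Suc m))"
proof -
  \<comment> \<open>The zero term at \<open>k = 0\<close> is added so that the reflection
    \<open>k \<mapsto> n - k\<close> preserves the range.\<close>
  have "(\<Sum>k=1..n. ((n - k) choose Suc m) * k) = (\<Sum>k=0..n. ((n - k) choose Suc m) * k)"
    by (rule sum.mono_neutral_left) auto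
  also have "\<dots> = (\<Sum>k=0..n. (n - k) * (k choose Suc m))"
    by (rule sum.reindex_bij_witness[of _ "\<lambda>k. n - k" "\<lambda>k. n - k"]) auto
  also have "\<dots> = (\<Sum>k=1..n. (n - k) * (k choose Suc m))"
    by (rule sum.mono_neutral_right) (auto simp: not_le)
  finally show ?thesis
    by (simp only: sum_diff_mult_choose)
qed

text \<open>Factoring out \<open>n (n - 1) (n - 2) / 24\<close> leaves
  \<open>(n - 3) + (n + 1) = 2 (n - 1)\<close>.\<close>

lemma choose_4_sum:
  "real ((n choose 4) + (Suc n choose 4)) = real n * (real n - 2) * (real n - 1)\<^sup>2 / 12"
proof -
  have "real (n choose 4) = real n * (real n - 1) * (real n - 2) * (real n - 3) / 24" for n
    by (simp add: binomial_gbinomial gbinomial_prod_rev eval_nat_numeral prod.atLeast0_lessThan_Suc)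
  from this[of n] this[of "Suc n"] show ?thesis
    by (simp add: field_simps power2_eq_square)
qed

theorem theorem3p6:
  fixes n :: nat
  assumes "n \<ge> 3"
  shows "total_occ [1,2,3] n = (n + 1) choose 4 \<and>
         total_occ [3,1,2] n = (n + 1) choose 4 \<and>
         real (total_occ [3,2,1] n) = real n * (real n - 2) * (real n - 1)\<^sup>2 / 12"
proof -
  have n: "n \<ge> 1"
    using assms by simp
  have "total_occ [1,2,3] n = (n + 1) choose 4"
    unfolding total_occ_eq[OF n] occ_count_123
    using sum_choose_upper[where m = 2] by (simp add: eval_nat_numeral)
  moreover have "total_occ [3,1,2] n = (n + 1) choose 4"
    unfolding total_occ_eq[OF n] occ_count_312
    using sum_diff_mult_choose[where m = 1] by (simp add: eval_nat_numeral)
  \<comment> \<open>Occurrences inside the decreasing block total \<open>n choose 4\<close>, those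
    ending in the increasing block \<open>Suc n choose 4\<close>.\<close>
  moreover have "total_occ [3,2,1] n = (n choose 4) + (Suc n choose 4)"
    unfolding total_occ_eq[OF n] occ_count_321 sum.distrib
    using sum_rev_choose_upper[where m = 3] sum_rev_choose_mult[where m = 1]
    by (simp add: eval_nat_numeral)
  ultimately show ?thesis
    by (simp only: choose_4_sum)
qed

end
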